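(* Let $n,m\ge1$, let $t_0<T$ be real numbers, let $U\subseteq\mathbb{R}^m$ be a nonempty compact set, and let $f=(f_1,\dots,f_n)^T:\mathbb{R}^n\times U\times[t_0,T]\to\mathbb{R}^n$ and $F:\mathbb{R}^n\times U\times[t_0,T]\to\mathbb{R}$. Assume: (i) $f$ and $F$ are continuous, and there is a modulus $\omega$ such that for each $t\in[t_0,T]$ and each of the functions $\phi(x,u)=f_1(x,u,t),\dots,f_n(x,u,t),F(x,u,t)$, $$|\phi(x,u)-\phi(y,u)|\le\omega(R,\|x-y\|)\qquad\text{for all }R>0,\ x,y\in B_R(\mathbb{R}^n),\ u\in U.$$ (ii) $\frac{\partial f}{\partial x}:\mathbb{R}^n\times U\times[t_0,T]\to\mathbb{R}^{n\times n}$ and $\frac{\partial F}{\partial x}:\mathbb{R}^n\times U\times[t_0,T]\to\mathbb{R}^n$ exist and are continuous, and there is a function $\omega_1:\mathbb{R}_+\to\mathbb{R}_+$ with $\lim_{R\to0}\omega_1(R)=0$ such that for each $t\in[t_0,T]$, each of the functions $\phi$ in (i) and each $x\in\mathbb{R}^n$, $$\Big|\phi(x+\Delta x,u)-\phi(x,u)-\frac{\partial\phi}{\partial x}(x,u)\Delta x\Big|\le\|\Delta x\|\,\omega_1(\|\Delta x\|)$$ for all sufficiently small $\Delta x\in\mathbb{R}^n$ and all $u\in U$ (smallness uniform in $u$). Let $\mathscr{H}(x,p,u,t):=\sum_{i=1}^np_if_i(x,u,t)-F(x,u,t)$, $H(x,p,t):=\sup_{u\in U}\mathscr{H}(x,p,u,t)$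 and $A(x,p,t):=\{u\in U:\mathscr{H}(x,p,u,t)=H(x,p,t)\}$. Let $x,p\in\mathbb{R}^n$ and $t\in[t_0,T]$. If $A(x,p,t)\ne\emptyset$ and $u\mapsto f(x,u,t)$ is constant on $A(x,p,t)$, then $H(x,\cdot,t)$ is differentiable at $p$. If $A(x,p,t)\ne\emptyset$ and $$u\mapsto\sum_{i=1}^np_i\frac{\partial f_i}{\partial x}(x,u,t)-\frac{\partial F}{\partial x}(x,u,t)$$ is constant on $A(x,p,t)$, then $H(\cdot,p,t)$ is differentiable at $x$.
   Context: Notation: $\mathbb{R}_+=[0,+\infty)$; $B_R(\mathbb{R}^n)$ is the open ball of radius $R$ centered at $0$. A modulus is a function $\omega:\mathbb{R}_+\times\mathbb{R}_+\to\mathbb{R}_+$ with $\omega(r,d)\le\omega(R,D)$ whenever $r\le R$, $d\le D$, and $\lim_{D\to0+}\omega(R,D)=0$ for every $R>0$. $\frac{\partial f_i}{\partial x}$ and $\frac{\partial F}{\partial x}$ denote gradients in $x$, and $\frac{\partial\phi}{\partial x}(x,u)\Delta x$ is the pairing of the gradient with $\Delta x$. *)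

theory Defs
  imports "HOL-Analysis.Analysis"
begin

text \<open>
  A modulus is a function on \<open>[0,\<infinity>) \<times> [0,\<infinity>)\<close>; its values at negative arguments are left
  unconstrained.
\<close>

definition is_modulus :: "(real \<Rightarrow> real \<Rightarrow> real) \<Rightarrow> bool" where
  "is_modulus \<omega> \<longleftrightarrow>
     (\<forall>r\<ge>0. \<forall>d\<ge>0. 0 \<le> \<omega> r d) \<and>
     (\<forall>r R d D. 0 \<le> r \<longrightarrow> r \<le> R \<longrightarrow> 0 \<le> d \<longrightarrow> d \<le> D \<longrightarrow> \<omega> r d \<le> \<omega> R D) \<and>
     (\<forall>R>0. ((\<lambda>D. \<omega> R D) \<longlongrightarrow> 0) (at_right 0))"

definition has_local_modulus ::
  "'b set \<Rightarrow> (real \<Rightarrow> real \<Rightarrow> real) \<Rightarrow> (real ^ 'n \<Rightarrow> 'b \<Rightarrow> real) \<Rightarrow> bool" where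
  "has_local_modulus U \<omega> \<phi> \<longleftrightarrow>
     (\<forall>R>0. \<forall>x\<in>ball 0 R. \<forall>y\<in>ball 0 R. \<forall>u\<in>U. \<bar>\<phi> x u - \<phi> y u\<bar> \<le> \<omega> R (norm (x - y)))"

text \<open>
  \<open>\<phi>x x u\<close> plays the role of the gradient of \<open>\<phi>(\<cdot>,u)\<close> at \<open>x\<close>. The neighbourhood of admissible
  increments may depend on \<open>x\<close> but not on \<open>u\<close>.
\<close>

definition uniform_expansion ::
  "'b set \<Rightarrow> (real \<Rightarrow> real) \<Rightarrow> (real ^ 'n \<Rightarrow> 'b \<Rightarrow> real) \<Rightarrow> (real ^ 'n \<Rightarrow> 'b \<Rightarrow> real ^ 'n) \<Rightarrow> bool" where
  "uniform_expansion U \<omega>1 \<phi> \<phi>x \<longleftrightarrow>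
     (\<forall>x. \<exists>\<delta>>0. \<forall>\<Delta>x. norm \<Delta>x < \<delta> \<longrightarrow>
        (\<forall>u\<in>U. \<bar>\<phi> (x + \<Delta>x) u - \<phi> x u - \<phi>x x u \<bullet> \<Delta>x\<bar> \<le> norm \<Delta>x * \<omega>1 (norm \<Delta>x)))"

definition pre_hamiltonian ::
  "(real ^ 'n \<Rightarrow> 'b \<Rightarrow> real \<Rightarrow> real ^ 'n) \<Rightarrow> (real ^ 'n \<Rightarrow> 'b \<Rightarrow> real \<Rightarrow> real) \<Rightarrow>
   real ^ 'n \<Rightarrow> real ^ 'n \<Rightarrow> 'b \<Rightarrow> real \<Rightarrow> real" where
  "pre_hamiltonian f F x p u t = (\<Sum>i\<in>UNIV. p $ i * f x u t $ i) - F x u t"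

definition hamiltonian ::
  "'b set \<Rightarrow> (real ^ 'n \<Rightarrow> 'b \<Rightarrow> real \<Rightarrow> real ^ 'n) \<Rightarrow> (real ^ 'n \<Rightarrow> 'b \<Rightarrow> real \<Rightarrow> real) \<Rightarrow>
   real ^ 'n \<Rightarrow> real ^ 'n \<Rightarrow> real \<Rightarrow> real" where
  "hamiltonian U f F x p t = (SUP u\<in>U. pre_hamiltonian f F x p u t)"

definition maximizers ::
  "'b set \<Rightarrow> (real ^ 'n \<Rightarrow> 'b \<Rightarrow> real \<Rightarrow> real ^ 'n) \<Rightarrow> (real ^ 'n \<Rightarrow> 'b \<Rightarrow> real \<Rightarrow> real) \<Rightarrow>
   real ^ 'n \<Rightarrow> real ^ 'n \<Rightarrow> real \<Rightarrow> 'b set" where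
  "maximizers U f F x p t = {u \<in> U. pre_hamiltonian f F x p u t = hamiltonian U f F x p t}"

end

theory Submission
  imports Defs
begin

text \<open>
  This is Danskin's theorem on the derivative of a supremum \<open>M y = (SUP u\<in>U. g y u)\<close>, with maximizers
  that need not be unique: it suffices that the gradient \<open>G u\<close> of \<open>g(\<cdot>,u)\<close> at \<open>z\<close> has the same
  value \<open>c\<close> at all maximizers \<open>u\<close> of \<open>g z\<close>; then \<open>c\<close> is the gradient of \<open>M\<close> at \<open>z\<close>.

  The lower bound \<open>M (z + h) \<ge> M z + c \<bullet> h - o(h)\<close> comes from expanding \<open>g(\<cdot>,u)\<close> at one fixed maximizer.
  For the upper bound, compactness of \<open>U\<close> gives for each tolerance \<open>e\<close> a gap \<open>d > 0\<close> such that every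
  \<open>u\<close> with \<open>g z u > M z - d\<close> has \<open>G u\<close> within \<open>e\<close> of \<open>c\<close> (lemma \<open>near_maximizers_near_gradient\<close>).
  Such \<open>u\<close> yield \<open>g (z + h) u \<le> M z + c \<bullet> h + O(e \<bar>h\<bar>)\<close>. For the other \<open>u\<close>, the gap \<open>d\<close> absorbs the
  change of \<open>g(\<cdot>,u)\<close>, which is \<open>O(\<bar>h\<bar>)\<close> uniformly in \<open>u\<close>. Lemma \<open>GDERIV_SUP\<close> combines the bounds.

  Both halves of the proposition are instances. In \<open>p\<close> the pre-Hamiltonian is affine with slope
  \<open>f x u t\<close>, so the expansion is exact. In \<open>x\<close> it is a linear combination of the components of \<open>f\<close>
  and of \<open>F\<close>, and the uniform expansions of these add up.
\<close>

section \<open>Gradients uniform in a parameter\<close>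

text \<open>
  The derivative of \<open>\<phi>(\<cdot>,u)\<close> at the single point \<open>z\<close>, with a remainder that is small uniformly in
  \<open>u\<close>. The tolerance \<open>e\<close> replaces an explicit rate, so that linear combinations need no
  bookkeeping of rates.
\<close>

definition has_uniform_gradient ::
  "'b set \<Rightarrow> ('a::real_inner \<Rightarrow> 'b \<Rightarrow> real) \<Rightarrow> ('b \<Rightarrow> 'a) \<Rightarrow> 'a \<Rightarrow> bool" where
  "has_uniform_gradient U \<phi> G z \<longleftrightarrow>
     (\<forall>e>0. \<forall>\<^sub>F h in nhds 0. \<forall>u\<in>U. \<bar>\<phi> (z + h) u - \<phi> z u - G u \<bullet> h\<bar> \<le> e * norm h)"

lemma has_uniform_gradientI:
  assumes "\<And>e. e > 0 \<Longrightarrow>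
    \<forall>\<^sub>F h in nhds 0. \<forall>u\<in>U. \<bar>\<phi> (z + h) u - \<phi> z u - G u \<bullet> h\<bar> \<le> e * norm h"
  shows "has_uniform_gradient U \<phi> G z"
  using assms by (auto simp: has_uniform_gradient_def)

lemma has_uniform_gradientD:
  assumes "has_uniform_gradient U \<phi> G z" "e > 0"
  obtains \<delta> where "\<delta> > 0"
    "\<And>h u. norm h < \<delta> \<Longrightarrow> u \<in> U \<Longrightarrow> \<bar>\<phi> (z + h) u - \<phi> z u - G u \<bullet> h\<bar> \<le> e * norm h"
  using assms unfolding has_uniform_gradient_def eventually_nhds_metric dist_norm
  by (metis diff_zero)

lemma has_uniform_gradient_affine:
  "has_uniform_gradient U (\<lambda>y u. y \<bullet> a u - b u) a z"
  by (rule has_uniform_gradientI) (simp add: inner_add_left inner_commute [of "a _"] always_eventually)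

lemma has_uniform_gradient_add:
  assumes "has_uniform_gradient U \<phi> G z" "has_uniform_gradient U \<psi> K z"
  shows "has_uniform_gradient U (\<lambda>y u. \<phi> y u + \<psi> y u) (\<lambda>u. G u + K u) z"
proof (rule has_uniform_gradientI)
  fix e :: real assume "e > 0"
  then have "e / 2 > 0" by simp
  with assms have
    "\<forall>\<^sub>F h in nhds 0. \<forall>u\<in>U. \<bar>\<phi> (z + h) u - \<phi> z u - G u \<bullet> h\<bar> \<le> e / 2 * norm h"
    "\<forall>\<^sub>F h in nhds 0. \<forall>u\<in>U. \<bar>\<psi> (z + h) u - \<psi> z u - K u \<bullet> h\<bar> \<le> e / 2 * norm h"
    unfolding has_uniform_gradient_def by blast+
  then show "\<forall>\<^sub>F h in nhds 0. \<forall>u\<in>U.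
      \<bar>\<phi> (z + h) u + \<psi> (z + h) u - (\<phi> z u + \<psi> z u) - (G u + K u) \<bullet> h\<bar> \<le> e * norm h"
  proof eventually_elim
    case (elim h)
    show ?case
    proof
      fix u assume "u \<in> U"
      with elim have "\<bar>\<phi> (z + h) u - \<phi> z u - G u \<bullet> h\<bar> \<le> e / 2 * norm h"
        "\<bar>\<psi> (z + h) u - \<psi> z u - K u \<bullet> h\<bar> \<le> e / 2 * norm h" by blast+
      then show "\<bar>\<phi> (z + h) u + \<psi> (z + h) u - (\<phi> z u + \<psi> z u) - (G u + K u) \<bullet> h\<bar> \<le> e * norm h"
        unfolding inner_add_left by linarith
    qed
  qed
qed

lemma has_uniform_gradient_scaleR:
  assumes "has_uniform_gradient U \<phi> G z"
  shows "has_uniform_gradient U (\<lambda>y u. a * \<phi> y u) (\<lambda>u. a *\<^sub>R G u) z"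
proof (rule has_uniform_gradientI)
  fix e :: real assume "e > 0"
  \<comment> \<open>The summand 1 keeps the tolerance meaningful when \<open>a = 0\<close>.\<close>
  define e' where "e' = e / (\<bar>a\<bar> + 1)"
  have "e' > 0" "\<bar>a\<bar> * e' \<le> e" using \<open>e > 0\<close> by (auto simp: e'_def field_simps)
  with assms have "\<forall>\<^sub>F h in nhds 0. \<forall>u\<in>U. \<bar>\<phi> (z + h) u - \<phi> z u - G u \<bullet> h\<bar> \<le> e' * norm h"
    unfolding has_uniform_gradient_def by blast
  then show "\<forall>\<^sub>F h in nhds 0. \<forall>u\<in>U.
      \<bar>a * \<phi> (z + h) u - a * \<phi> z u - (a *\<^sub>R G u) \<bullet> h\<bar> \<le> e * norm h"
  proof eventually_elim
    case (elim h)
    show ?case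
    proof
      fix u assume "u \<in> U"
      have "\<bar>a * \<phi> (z + h) u - a * \<phi> z u - (a *\<^sub>R G u) \<bullet> h\<bar>
          = \<bar>a\<bar> * \<bar>\<phi> (z + h) u - \<phi> z u - G u \<bullet> h\<bar>"
        by (simp add: abs_mult [symmetric] algebra_simps)
      also have "\<dots> \<le> \<bar>a\<bar> * (e' * norm h)"
        using elim \<open>u \<in> U\<close> by (intro mult_left_mono) auto
      also have "\<dots> \<le> e * norm h"
        using mult_right_mono [OF \<open>\<bar>a\<bar> * e' \<le> e\<close> norm_ge_zero [of h]] by (simp add: mult.assoc)
      finally show "\<bar>a * \<phi> (z + h) u - a * \<phi> z u - (a *\<^sub>R G u) \<bullet> h\<bar> \<le> e * norm h" .
    qed
  qed
qed

lemma has_uniform_gradient_diff: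
  assumes "has_uniform_gradient U \<phi> G z" "has_uniform_gradient U \<psi> K z"
  shows "has_uniform_gradient U (\<lambda>y u. \<phi> y u - \<psi> y u) (\<lambda>u. G u - K u) z"
  using has_uniform_gradient_add [OF assms(1) has_uniform_gradient_scaleR [OF assms(2), of "- 1"]]
  by simp

lemma has_uniform_gradient_sum:
  assumes "finite I" "\<And>i. i \<in> I \<Longrightarrow> has_uniform_gradient U (\<phi> i) (G i) z"
  shows "has_uniform_gradient U (\<lambda>y u. \<Sum>i\<in>I. \<phi> i y u) (\<lambda>u. \<Sum>i\<in>I. G i u) z"
  using assms
proof (induction I rule: finite_induct)
  case empty
  then show ?case by (auto intro: has_uniform_gradientI)
next
  case (insert i I)
  then show ?case by (simp add: has_uniform_gradient_add)
qed

lemma uniform_expansion_imp_has_uniform_gradient: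
  assumes "uniform_expansion U \<omega> \<phi> G" and lim: "(\<omega> \<longlongrightarrow> 0) (at 0 within {0..})"
  shows "has_uniform_gradient U \<phi> (G z) z"
proof (rule has_uniform_gradientI)
  fix e :: real assume "e > 0"
  from assms(1) obtain \<delta> where "\<delta> > 0" and \<delta>:
    "\<And>h u. norm h < \<delta> \<Longrightarrow> u \<in> U \<Longrightarrow>
       \<bar>\<phi> (z + h) u - \<phi> z u - G z u \<bullet> h\<bar> \<le> norm h * \<omega> (norm h)"
    unfolding uniform_expansion_def by blast
  from tendstoD [OF lim \<open>e > 0\<close>] obtain \<eta> where "\<eta> > 0" and \<eta>:
    "\<And>r. 0 \<le> r \<Longrightarrow> r \<noteq> 0 \<Longrightarrow> r < \<eta> \<Longrightarrow> \<bar>\<omega> r\<bar> < e"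
    unfolding eventually_at by (auto simp: dist_real_def)
  have "\<bar>\<phi> (z + h) u - \<phi> z u - G z u \<bullet> h\<bar> \<le> e * norm h"
    if "norm h < min \<delta> \<eta>" "u \<in> U" for h u
  \<comment> \<open>The limit says nothing about \<open>\<omega> 0\<close>, hence the case distinction.\<close>
  proof (cases "h = 0")
    case False
    have "\<bar>\<phi> (z + h) u - \<phi> z u - G z u \<bullet> h\<bar> \<le> norm h * \<omega> (norm h)"
      using \<delta> that by simp
    also have "\<dots> \<le> norm h * e"
      using \<eta> [of "norm h"] that False by (intro mult_left_mono) auto
    finally show ?thesis by (simp add: mult.commute)
  qed simp
  then show "\<forall>\<^sub>F h in nhds 0. \<forall>u\<in>U. \<bar>\<phi> (z + h) u - \<phi> z u - G z u \<bullet> h\<bar> \<le> e * norm h"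
    unfolding eventually_nhds_metric dist_norm using \<open>\<delta> > 0\<close> \<open>\<eta> > 0\<close>
    by (intro exI [of _ "min \<delta> \<eta>"]) auto
qed

section \<open>Differentiating a supremum\<close>

text \<open>
  The function \<open>max (M - g u) (e - norm (G u - c))\<close> is positive on \<open>U\<close>, as its second entry is \<open>e\<close>
  wherever its first one vanishes. Its minimum over the compact set \<open>U\<close> is the gap \<open>d\<close>.
\<close>

lemma near_maximizers_near_gradient:
  fixes g :: "'b::topological_space \<Rightarrow> real" and G :: "'b \<Rightarrow> 'a::real_normed_vector"
  assumes "compact U" "continuous_on U g" "continuous_on U G"
    and le: "\<And>u. u \<in> U \<Longrightarrow> g u \<le> M"
    and eq: "\<And>u. u \<in> U \<Longrightarrow> g u = M \<Longrightarrow> G u = c"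
    and "e > 0"
  obtains d where "d > 0" "\<And>u. u \<in> U \<Longrightarrow> g u > M - d \<Longrightarrow> norm (G u - c) < e"
proof (cases "U = {}")
  case True
  then show ?thesis using that [of 1] by simp
next
  case False
  let ?k = "\<lambda>u. max (M - g u) (e - norm (G u - c))"
  have "continuous_on U ?k" by (intro continuous_intros assms)
  then obtain v where v: "v \<in> U" "\<And>u. u \<in> U \<Longrightarrow> ?k v \<le> ?k u"
    using continuous_attains_inf [OF \<open>compact U\<close> False] by blast
  have "?k v > 0" using le [OF v(1)] eq [OF v(1)] \<open>e > 0\<close> by (cases "g v = M") auto
  moreover have "norm (G u - c) < e" if "u \<in> U" "g u > M - ?k v" for u
    using v(2) [OF that(1)] that(2) \<open>?k v > 0\<close> by linarith
  ultimately show ?thesis using that by blast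
qed

lemma GDERIV_SUP:
  fixes g :: "'a::real_inner \<Rightarrow> 'b::topological_space \<Rightarrow> real"
  assumes "compact U" and contg: "continuous_on U (g z)" and contG: "continuous_on U G"
    and grad: "has_uniform_gradient U g G z"
    and v: "v \<in> U" "g z v = (SUP u\<in>U. g z u)"
    and const: "\<And>u. u \<in> U \<Longrightarrow> g z u = (SUP u\<in>U. g z u) \<Longrightarrow> G u = c"
  shows "GDERIV (\<lambda>y. SUP u\<in>U. g y u) z :> c"
proof -
  define M where "M = (\<lambda>y. SUP u\<in>U. g y u)"
  have le_M: "g z u \<le> M z" if "u \<in> U" for u
    unfolding M_def
    by (rule cSUP_upper [OF that])
       (intro bounded_imp_bdd_above compact_imp_bounded compact_continuous_image contg assms)
  have "bounded (G ` U)"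
    by (intro compact_imp_bounded compact_continuous_image contG assms)
  then obtain K where K: "\<And>u. u \<in> U \<Longrightarrow> norm (G u) \<le> K"
    by (auto simp: bounded_iff)
  have "norm c \<le> K" "0 \<le> K"
    using K [OF v(1)] const [OF v] norm_ge_zero [of "G v"] by (simp, linarith)
  have "\<exists>\<delta>>0. \<forall>y. norm (y - z) < \<delta> \<longrightarrow> norm (M y - M z - (y - z) \<bullet> c) \<le> e * norm (y - z)"
    if "e > 0" for e
  proof -
    obtain \<delta> where "\<delta> > 0" and \<delta>: "\<And>h u. norm h < \<delta> \<Longrightarrow> u \<in> U \<Longrightarrow>
        \<bar>g (z + h) u - g z u - G u \<bullet> h\<bar> \<le> e / 2 * norm h"
      using has_uniform_gradientD [OF grad, of "e / 2"] \<open>e > 0\<close> by auto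
    obtain d where "d > 0" and d: "\<And>u. u \<in> U \<Longrightarrow> g z u > M z - d \<Longrightarrow> norm (G u - c) < e / 2"
      using near_maximizers_near_gradient [OF \<open>compact U\<close> contg contG le_M, of c "e / 2"]
        const \<open>e > 0\<close> by (auto simp: M_def)
    \<comment> \<open>Away from the near-maximizers, the increment of \<open>g(\<cdot>,u)\<close> and the term \<open>c \<bullet> h\<close> are each
      bounded by \<open>K * norm h\<close>, up to the remainder; \<open>\<eta>\<close> makes their total at most \<open>d\<close>.\<close>
    define \<eta> where "\<eta> = d / (2 * K + e)"
    have "\<eta> > 0" using \<open>d > 0\<close> \<open>0 \<le> K\<close> \<open>e > 0\<close> by (simp add: \<eta>_def)
    have bound: "\<bar>M (z + h) - M z - c \<bullet> h\<bar> \<le> e * norm h" if h: "norm h < min \<delta> \<eta>" for h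
    proof -
      have ch: "\<bar>c \<bullet> h\<bar> \<le> K * norm h"
        using Cauchy_Schwarz_ineq2 [of c h] mult_right_mono [OF \<open>norm c \<le> K\<close> norm_ge_zero [of h]]
        by linarith
      have "norm h * (2 * K + e) \<le> d"
        using h \<open>0 \<le> K\<close> \<open>e > 0\<close> by (simp add: \<eta>_def pos_less_divide_eq)
      then have small: "2 * (K * norm h) + e * norm h \<le> d" by (simp add: algebra_simps)
      have rem: "\<bar>g (z + h) u - g z u - G u \<bullet> h\<bar> \<le> e / 2 * norm h" if "u \<in> U" for u
        using \<delta> h that by simp
      have eh: "0 \<le> e * norm h" using \<open>e > 0\<close> by simp
      have upper: "g (z + h) u \<le> M z + c \<bullet> h + e * norm h" if "u \<in> U" for u
      proof (cases "g z u > M z - d")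
        case True
        have "(G u - c) \<bullet> h \<le> norm (G u - c) * norm h" by (rule norm_cauchy_schwarz)
        also have "\<dots> \<le> e / 2 * norm h"
          using d [OF that True] by (intro mult_right_mono) auto
        finally have "G u \<bullet> h \<le> c \<bullet> h + e / 2 * norm h" by (simp add: inner_diff_left)
        then show ?thesis
          using rem [OF that] le_M [OF that] by linarith
      next
        case False
        have "G u \<bullet> h \<le> norm (G u) * norm h" by (rule norm_cauchy_schwarz)
        also have "\<dots> \<le> K * norm h" using K [OF that] by (intro mult_right_mono) auto
        finally show ?thesis
          using rem [OF that] False small ch eh by linarith
      qed
      have "M (z + h) \<le> M z + c \<bullet> h + e * norm h"
        unfolding M_def by (rule cSUP_least) (use v upper in \<open>auto simp: M_def\<close>)
      moreover have "g (z + h) v \<le> M (z + h)"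
        unfolding M_def using upper by (intro cSUP_upper [OF v(1)] bdd_aboveI2)
      moreover have "g z v = M z" "G v \<bullet> h = c \<bullet> h"
        using v const [OF v] by (simp_all add: M_def)
      ultimately show ?thesis
        using rem [OF v(1)] eh by linarith
    qed
    show ?thesis
    proof (intro exI [of _ "min \<delta> \<eta>"] conjI allI impI)
      show "min \<delta> \<eta> > 0" using \<open>\<delta> > 0\<close> \<open>\<eta> > 0\<close> by simp
    next
      fix y assume "norm (y - z) < min \<delta> \<eta>"
      from bound [OF this] show "norm (M y - M z - (y - z) \<bullet> c) \<le> e * norm (y - z)"
        by (simp add: inner_commute)
    qed
  qed
  then show ?thesis
    unfolding gderiv_def has_derivative_at_alt M_def [symmetric]
    by (auto intro: bounded_linear_inner_left)
qed

section \<open>The Hamiltonian\<close>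

lemma pre_hamiltonian_inner: "pre_hamiltonian f F x p u t = p \<bullet> f x u t - F x u t"
  by (simp add: pre_hamiltonian_def inner_vec_def)

text \<open>
  The common form of both halves: \<open>g\<close> is the pre-Hamiltonian as a function of \<open>p\<close> or of \<open>x\<close>.
\<close>

lemma SUP_differentiable_if_gradient_constant_on_maximizers:
  fixes g :: "'a::real_inner \<Rightarrow> 'b::topological_space \<Rightarrow> real"
  assumes "compact U" "continuous_on U (g z)" "continuous_on U G" "has_uniform_gradient U g G z"
    and "A = {u \<in> U. g z u = (SUP u\<in>U. g z u)}" "A \<noteq> {}" "G constant_on A"
  shows "(\<lambda>y. SUP u\<in>U. g y u) differentiable (at z)"
proof -
  obtain c where c: "\<And>u. u \<in> A \<Longrightarrow> G u = c"
    using \<open>G constant_on A\<close> by (auto simp: constant_on_def)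
  obtain v where "v \<in> A" using \<open>A \<noteq> {}\<close> by blast
  then have "GDERIV (\<lambda>y. SUP u\<in>U. g y u) z :> c"
    using assms c by (intro GDERIV_SUP [of U g z G v c]) auto
  then show ?thesis by (auto simp: gderiv_def differentiable_def)
qed

theorem proposition4p2:
  fixes t0 T :: real
    and U :: "(real ^ 'm) set"
    and f :: "real ^ 'n \<Rightarrow> real ^ 'm \<Rightarrow> real \<Rightarrow> real ^ 'n"
    and F :: "real ^ 'n \<Rightarrow> real ^ 'm \<Rightarrow> real \<Rightarrow> real"
    and fx :: "real ^ 'n \<Rightarrow> real ^ 'm \<Rightarrow> real \<Rightarrow> real ^ 'n ^ 'n"
    and Fx :: "real ^ 'n \<Rightarrow> real ^ 'm \<Rightarrow> real \<Rightarrow> real ^ 'n"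
    and x p :: "real ^ 'n"
    and t :: real
  assumes "t0 < T"
    and "compact U" and "U \<noteq> {}"
    and f_cont: "continuous_on (UNIV \<times> U \<times> {t0..T}) (\<lambda>(x, u, t). f x u t)"
    and F_cont: "continuous_on (UNIV \<times> U \<times> {t0..T}) (\<lambda>(x, u, t). F x u t)"
    and modulus: "\<exists>\<omega>. is_modulus \<omega> \<and>
       (\<forall>t\<in>{t0..T}. (\<forall>i. has_local_modulus U \<omega> (\<lambda>x u. f x u t $ i)) \<and>
                     has_local_modulus U \<omega> (\<lambda>x u. F x u t))"
    and f_grad: "\<And>x u t i. u \<in> U \<Longrightarrow> t \<in> {t0..T} \<Longrightarrow> GDERIV (\<lambda>y. f y u t $ i) x :> fx x u t $ i"
    and F_grad: "\<And>x u t. u \<in> U \<Longrightarrow> t \<in> {t0..T} \<Longrightarrow> GDERIV (\<lambda>y. F y u t) x :> Fx x u t"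
    and fx_cont: "continuous_on (UNIV \<times> U \<times> {t0..T}) (\<lambda>(x, u, t). fx x u t)"
    and Fx_cont: "continuous_on (UNIV \<times> U \<times> {t0..T}) (\<lambda>(x, u, t). Fx x u t)"
    and expansion: "\<exists>\<omega>1. (\<forall>r\<ge>0. 0 \<le> \<omega>1 r) \<and> (\<omega>1 \<longlongrightarrow> 0) (at 0 within {0..}) \<and>
       (\<forall>t\<in>{t0..T}. (\<forall>i. uniform_expansion U \<omega>1 (\<lambda>x u. f x u t $ i) (\<lambda>x u. fx x u t $ i)) \<and>
                     uniform_expansion U \<omega>1 (\<lambda>x u. F x u t) (\<lambda>x u. Fx x u t))"
    and "t \<in> {t0..T}"
  shows "(maximizers U f F x p t \<noteq> {} \<and>
          (\<lambda>u. f x u t) constant_on maximizers U f F x p t \<longrightarrow>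
            (\<lambda>q. hamiltonian U f F x q t) differentiable (at p)) \<and>
         (maximizers U f F x p t \<noteq> {} \<and>
          (\<lambda>u. (\<Sum>i\<in>UNIV. p $ i *\<^sub>R (fx x u t $ i)) - Fx x u t) constant_on maximizers U f F x p t \<longrightarrow>
            (\<lambda>y. hamiltonian U f F y p t) differentiable (at x))"
proof -
  \<comment> \<open>Freezing the state and the time leaves continuous functions of the control.\<close>
  have slice: "continuous_on U (\<lambda>u. k x u t)"
    if "continuous_on (UNIV \<times> U \<times> {t0..T}) (\<lambda>(x, u, t). k x u t)"
    for k :: "real ^ 'n \<Rightarrow> real ^ 'm \<Rightarrow> real \<Rightarrow> 'c::topological_space"
  proof -
    have "continuous_on U ((\<lambda>(x, u, t). k x u t) \<circ> (\<lambda>u. (x, u, t)))"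
      by (rule continuous_on_compose)
         (auto intro!: continuous_intros continuous_on_subset [OF that] \<open>t \<in> {t0..T}\<close>)
    then show ?thesis by (simp add: o_def)
  qed
  note cont = slice [OF f_cont] slice [OF F_cont] slice [OF fx_cont] slice [OF Fx_cont]
  have cont_H: "continuous_on U (\<lambda>u. pre_hamiltonian f F x p u t)"
    unfolding pre_hamiltonian_inner by (intro continuous_intros cont)
  obtain \<omega>1 where lim: "(\<omega>1 \<longlongrightarrow> 0) (at 0 within {0..})"
    and f_exp: "\<And>i. uniform_expansion U \<omega>1 (\<lambda>x u. f x u t $ i) (\<lambda>x u. fx x u t $ i)"
    and F_exp: "uniform_expansion U \<omega>1 (\<lambda>x u. F x u t) (\<lambda>x u. Fx x u t)"
    using expansion \<open>t \<in> {t0..T}\<close> by blast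
  let ?G = "\<lambda>u. (\<Sum>i\<in>UNIV. p $ i *\<^sub>R (fx x u t $ i)) - Fx x u t"
  have grad_p: "has_uniform_gradient U (\<lambda>q u. pre_hamiltonian f F x q u t) (\<lambda>u. f x u t) p"
    unfolding pre_hamiltonian_inner by (rule has_uniform_gradient_affine)
  have grad_x: "has_uniform_gradient U (\<lambda>y u. pre_hamiltonian f F y p u t) ?G x"
    unfolding pre_hamiltonian_def
    by (intro has_uniform_gradient_diff has_uniform_gradient_sum has_uniform_gradient_scaleR finite
        uniform_expansion_imp_has_uniform_gradient [OF f_exp lim]
        uniform_expansion_imp_has_uniform_gradient [OF F_exp lim])
  have cont_G: "continuous_on U ?G" by (intro continuous_intros cont)
  show ?thesis
    unfolding hamiltonian_def
    using SUP_differentiable_if_gradient_constant_on_maximizers [OF \<open>compact U\<close> cont_H cont(1) grad_p]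
      SUP_differentiable_if_gradient_constant_on_maximizers [OF \<open>compact U\<close> cont_H cont_G grad_x]
    by (auto simp: maximizers_def hamiltonian_def)
qed

end
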